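(* Suppose that $$\epsilon<\min\left\{\inf_{\|\mathbf{u}\|=1}\left(\limsup_{j\to\infty}\sqrt[j]{\tfrac{r_j(\mathbf{u})}{j!}}\right)^{-1},\ \frac{2\delta(1-\alpha L)}{\alpha M(2Ln^2+\delta)}+\mathcal{O}(\epsilon^2)\right\}\quad\text{when }\alpha\in\left(0,\tfrac1L-\mathcal{O}(\epsilon)\right],$$ and $$\epsilon<\min\left\{\inf_{\|\mathbf{u}\|=1}\left(\limsup_{j\to\infty}\sqrt[j]{\tfrac{r_j(\mathbf{u})}{j!}}\right)^{-1},\ \frac{2L\delta}{M(2Ln^2-\delta)}+\mathcal{O}(\epsilon^2)\right\}\quad\text{when }\alpha\in\left(\tfrac1L-\mathcal{O}(\epsilon),\tfrac1L\right].$$ Then for every value of the parameter $\tau$ there exists a lower bound on the squared radial distance $\|\tilde{\mathbf{u}}^\tau_K\|^2$ for all $K$ in the range $1\le K\le\sup_\tau\{K^\tau_{exit}\}$, provided $K\epsilon\ll1$. Moreover, this lower bound can be expressed using a function of $K$, the trajectory function $\Psi(K)$: for $1\le K<\sup_\tau\{K^\tau_{exit}\}$, $$\epsilon^2\ge\inf_\tau\|\tilde{\mathbf{u}}^\tau_K\|^2>\epsilon^2\,\Psi(K),$$ where $$\Psi(K)=\left(c_1^{2K}-2Kc_2^{2K-1}b_1-b_2c_3^Kc_2^K-b_2c_3^{2K}\right)\sum_{i\in\mathcal{N}_S}(\theta^s_i)^2+\left(c_4^{2K}-2Kc_3^{2K-1}b_1-b_2c_3^Kc_2^K-b_2c_3^{2K}\right)\sum_{j\in\mathcal{N}_{US}}(\theta^{us}_j)^2$$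 with $c_1=1-\alpha L-\frac{\alpha\epsilon M}{2}-\mathcal{O}(\epsilon^2)$, $c_2=1-\alpha\beta+\frac{\alpha\epsilon M}{2}+\mathcal{O}(\epsilon^2)$, $c_3=1+\alpha L+\frac{\alpha\epsilon M}{2}+\mathcal{O}(\epsilon^2)$, $c_4=1+\alpha\beta-\frac{\alpha\epsilon M}{2}-\mathcal{O}(\epsilon^2)$, $b_1=\frac{\alpha\epsilon MLn}{2\delta}+\mathcal{O}(\epsilon^2)$, and $$b_2=\frac{\left(\frac{\alpha\epsilon MLn}{2\delta}+\mathcal{O}(\epsilon^2)\right)\left(1+\mathcal{O}(K\epsilon)\right)}{\alpha L+\alpha\beta+\mathcal{O}(\epsilon^2)}.$$
   Context: Assumptions on $f:\mathbb{R}^n\to\mathbb{R}$: (i) $f$ is globally $\mathcal{C}^2$ and real analytic in sufficiently large neighborhoods of its saddle points; (ii) $\|\nabla f(\mathbf{x})-\nabla f(\mathbf{y})\|\le L\|\mathbf{x}-\mathbf{y}\|$; (iii) $\|\nabla^2 f(\mathbf{x})-\nabla^2 f(\mathbf{y})\|_2\le M\|\mathbf{x}-\mathbf{y}\|$; (iv) at every critical point of $f$, all eigenvalues of the Hessian have absolute value $>\beta$, where $\beta>0$. $\mathbf{x}^*$ is a strict saddle point of $f$ ($\nabla f(\mathbf{x}^* )=\mathbf{0}$; the Hessian has both positive and negative eigenvalues). $(\lambda_i(0),\mathbf{v}_i(0))_{i=1}^n$ are the eigenvalue–orthonormal eigenvector pairs of $\nabla^2 f(\mathbf{x}^* )$;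 the eigenvalues are non-degenerate, with $|\lambda_i(0)-\lambda_l(0)|\ge\delta$ for $i\ne l$, where $\delta=\Omega(\epsilon^{1-a})$ for some $a\in(0,1]$. $\mathcal{N}_S=\{i:\lambda_i(0)>0\}$, $\mathcal{N}_{US}=\{j:\lambda_j(0)<0\}$. Gradient descent is $\mathbf{x}_{k+1}=\mathbf{x}_k-\alpha\nabla f(\mathbf{x}_k)$ with constant step size $\alpha\le\frac1L$; $\mathcal{B}_\epsilon(\mathbf{x}^* )$ is the open ball of (small) radius $\epsilon$ about $\mathbf{x}^*$; $\mathbf{u}_k=\mathbf{x}_k-\mathbf{x}^*$, and $\mathbf{x}_0$ lies on the boundary of the ball, so $\|\mathbf{u}_0\|=\epsilon$. The signs of the eigenvectors are chosen so that $\epsilon\theta^s_i=\langle\mathbf{u}_0,\mathbf{v}_i(0)\rangle\ge0$ for $i\in\mathcal{N}_S$ and $\epsilon\theta^{us}_j=\langle\mathbf{u}_0,\mathbf{v}_j(0)\rangle\ge0$ for $j\in\mathcal{N}_{US}$; thus $\sum_i(\theta^s_i)^2+\sum_j(\theta^{us}_j)^2=1$. $r_j(\mathbf{u})=\left\|\frac{d^j}{dw^j}\nabla^2 f(\mathbf{x}^*+w\mathbf{u})\big|_{w=0}\right\|_2$. $\epsilon$-precision trajectories. Given coefficient sequences $c^s_i(k)$ ($i\in\mathcal{N}_S$), $c^{us}_j(k)$ ($j\in\mathcal{N}_{US}$), $d_{i,l}(k)$ ($i\neq l$), set $$\tilde{\mathbf{u}}_K=\epsilon\sum_{i\in\mathcal{N}_S}\Big(\prod_{k=0}^{K-1}c^s_i(k)\theta^s_i+\sum_{l\in\mathcal{N}_S}\sum_{r=0}^{K-1}\prod_{k=0}^{r-1}c^s_i(k)\,d_{i,l}(r)\prod_{k=r+1}^{K-1}c^s_l(k)\theta^s_l+\sum_{l\in\mathcal{N}_{US}}\sum_{r=0}^{K-1}\prod_{k=0}^{r-1}c^s_i(k)\,d_{i,l}(r)\prod_{k=r+1}^{K-1}c^{us}_l(k)\theta^{us}_l\Big)\mathbf{v}_i(0)$$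 $$+\epsilon\sum_{j\in\mathcal{N}_{US}}\Big(\prod_{k=0}^{K-1}c^{us}_j(k)\theta^{us}_j+\sum_{l\in\mathcal{N}_S}\sum_{r=0}^{K-1}\prod_{k=0}^{r-1}c^{us}_j(k)\,d_{j,l}(r)\prod_{k=r+1}^{K-1}c^s_l(k)\theta^s_l+\sum_{l\in\mathcal{N}_{US}}\sum_{r=0}^{K-1}\prod_{k=0}^{r-1}c^{us}_j(k)\,d_{j,l}(r)\prod_{k=r+1}^{K-1}c^{us}_l(k)\theta^{us}_l\Big)\mathbf{v}_j(0),$$ where terms with equal indices in $d$ are absent. This is the expansion, to first order in $\epsilon$, of the gradient-descent radial vector $\mathbf{u}_K$ in the ball. The coefficients are known only up to the intervals $$1-\alpha L-\tfrac{\alpha\epsilon M}{2}-\mathcal{O}(\epsilon^2)\le c^s_i(k)\le1-\alpha\beta+\tfrac{\alpha\epsilon M}{2}+\mathcal{O}(\epsilon^2),$$ $$1+\alpha\beta-\tfrac{\alpha\epsilon M}{2}-\mathcal{O}(\epsilon^2)\le c^{us}_j(k)\le1+\alpha L+\tfrac{\alpha\epsilon M}{2}+\mathcal{O}(\epsilon^2),\qquad |d_{i,l}(k)|\le\tfrac{\alpha\epsilon ML}{2\delta}+\mathcal{O}(\epsilon^2).$$ Each admissible choice of the coefficient sequences is indexed by a parameter $\tau$ and gives an $\epsilon$-precision trajectory $\{\tilde{\mathbf{u}}^\tau_K\}$ for the fixed $\mathbf{u}_0$; suprema and infima over $\tau$ range over all of these. The exit time is $K^\tau_{exit}=\inf\{K\ge1:\|\tilde{\mathbf{u}}^\tau_K\|^2>\epsilon^2\}$.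 The analysis is to first order in $\epsilon$; the $\mathcal{O}(\epsilon^2)$ terms account for the approximation. *)

theory Defs
  imports "HOL-Analysis.Analysis"
begin

section \<open>Gradient, Hessian, smoothness\<close>

definition grad :: "(real^'n \<Rightarrow> real) \<Rightarrow> real^'n \<Rightarrow> real^'n" where
  "grad f x = (\<chi> i. frechet_derivative f (at x) (axis i 1))"

definition hess :: "(real^'n \<Rightarrow> real) \<Rightarrow> real^'n \<Rightarrow> real^'n^'n" where
  "hess f x = jacobian (grad f) (at x)"

definition C2_function :: "(real^'n \<Rightarrow> real) \<Rightarrow> bool" where
  "C2_function f \<longleftrightarrow>
     (\<forall>x. f differentiable (at x)) \<and> (\<forall>x. grad f differentiable (at x)) \<and>
     continuous_on UNIV (hess f)"

text \<open>Local expansion into an absolutely convergent multivariate power series;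
  the index \<open>m :: 'n \<Rightarrow> nat\<close> is a multi-index.\<close>
definition real_analytic_on :: "(real^'n \<Rightarrow> real) \<Rightarrow> (real^'n) set \<Rightarrow> bool" where
  "real_analytic_on f U \<longleftrightarrow>
     (\<forall>x\<in>U. \<exists>r>0. \<exists>a :: ('n \<Rightarrow> nat) \<Rightarrow> real. \<forall>h. norm h < r \<longrightarrow>
        ((\<lambda>m. a m * (\<Prod>i\<in>UNIV. (h $ i) ^ m i)) has_sum f (x + h)) UNIV)"

definition mat_norm2 :: "real^'n^'n \<Rightarrow> real" where
  "mat_norm2 A = onorm (\<lambda>x. A *v x)"

definition is_eigenvalue :: "real^'n^'n \<Rightarrow> real \<Rightarrow> bool" where
  "is_eigenvalue A lam \<longleftrightarrow> (\<exists>x. x \<noteq> 0 \<and> A *v x = lam *\<^sub>R x)"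

definition critical_point :: "(real^'n \<Rightarrow> real) \<Rightarrow> real^'n \<Rightarrow> bool" where
  "critical_point f x \<longleftrightarrow> grad f x = 0"

definition strict_saddle :: "(real^'n \<Rightarrow> real) \<Rightarrow> real^'n \<Rightarrow> bool" where
  "strict_saddle f x \<longleftrightarrow> critical_point f x \<and>
     (\<exists>lam. is_eigenvalue (hess f x) lam \<and> lam > 0) \<and>
     (\<exists>lam. is_eigenvalue (hess f x) lam \<and> lam < 0)"

text \<open>The radius \<open>\<epsilon>\<close> makes ``sufficiently large neighborhood'' precise: the
  neighborhood of analyticity of a saddle point contains the closed ball of radius \<open>\<epsilon>\<close>.
  Under the last conjunct every saddle point is a strict saddle.\<close>
definition standing_assumptions ::
  "(real^'n \<Rightarrow> real) \<Rightarrow> real \<Rightarrow> real \<Rightarrow> real \<Rightarrow> real \<Rightarrow> bool" where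
  "standing_assumptions f L M \<beta> \<epsilon> \<longleftrightarrow>
     C2_function f \<and>
     (\<forall>y. strict_saddle f y \<longrightarrow> (\<exists>U. open U \<and> cball y \<epsilon> \<subseteq> U \<and> real_analytic_on f U)) \<and>
     (\<forall>x y. norm (grad f x - grad f y) \<le> L * norm (x - y)) \<and>
     (\<forall>x y. mat_norm2 (hess f x - hess f y) \<le> M * norm (x - y)) \<and>
     (\<forall>x lam. critical_point f x \<and> is_eigenvalue (hess f x) lam \<longrightarrow> \<bar>lam\<bar> > \<beta>)"

definition orthonormal_eigenpairs ::
  "real^'n^'n \<Rightarrow> ('n \<Rightarrow> real) \<Rightarrow> ('n \<Rightarrow> real^'n) \<Rightarrow> bool" where
  "orthonormal_eigenpairs A lam v \<longleftrightarrow>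
     (\<forall>i. A *v v i = lam i *\<^sub>R v i) \<and>
     (\<forall>i l. v i \<bullet> v l = (if i = l then 1 else 0))"

section \<open>Radius of convergence of the Hessian along rays\<close>

definition hess_deriv_norm ::
  "(real^'n \<Rightarrow> real) \<Rightarrow> real^'n \<Rightarrow> nat \<Rightarrow> real^'n \<Rightarrow> real" where
  "hess_deriv_norm f xs j u =
     mat_norm2 (((\<lambda>g w. vector_derivative g (at w)) ^^ j)
       (\<lambda>w::real. hess f (xs + w *\<^sub>R u)) 0)"

text \<open>In \<open>ereal\<close>, \<open>inverse 0 = \<infinity>\<close>.\<close>
definition conv_radius_hess :: "(real^'n \<Rightarrow> real) \<Rightarrow> real^'n \<Rightarrow> ereal" where
  "conv_radius_hess f xs =
     (INF u\<in>{u. norm u = 1}.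
        inverse (limsup (\<lambda>j. ereal (root j (hess_deriv_norm f xs j u / fact j)))))"

section \<open>Epsilon-precision trajectories\<close>

definition stable_idx :: "('n \<Rightarrow> real) \<Rightarrow> 'n set" where
  "stable_idx lam = {i. lam i > 0}"

definition unstable_idx :: "('n \<Rightarrow> real) \<Rightarrow> 'n set" where
  "unstable_idx lam = {j. lam j < 0}"

text \<open>A parameter value \<open>\<tau>\<close> is a pair \<open>(c, d)\<close> of coefficient sequences. Since the stable and
  unstable indices are disjoint, one family \<open>c\<close> carries both \<open>c\<^sup>s\<close> and \<open>c\<^sup>u\<^sup>s\<close>, and one
  family \<open>\<theta>\<close> carries both \<open>\<theta>\<^sup>s\<close> and \<open>\<theta>\<^sup>u\<^sup>s\<close>.\<close>
type_synonym 'n coeffs = "('n \<Rightarrow> nat \<Rightarrow> real) \<times> ('n \<Rightarrow> 'n \<Rightarrow> nat \<Rightarrow> real)"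

definition coupling_term :: "'n coeffs \<Rightarrow> ('n \<Rightarrow> real) \<Rightarrow> nat \<Rightarrow> 'n \<Rightarrow> 'n \<Rightarrow> real" where
  "coupling_term \<tau> \<theta> K i l = (case \<tau> of (c, d) \<Rightarrow>
     \<Sum>r<K. (\<Prod>k<r. c i k) * d i l r * (\<Prod>k\<in>{r<..<K}. c l k) * \<theta> l)"

definition traj_coord ::
  "('n \<Rightarrow> real) \<Rightarrow> 'n coeffs \<Rightarrow> ('n \<Rightarrow> real) \<Rightarrow> nat \<Rightarrow> 'n \<Rightarrow> real" where
  "traj_coord lam \<tau> \<theta> K i =
     (\<Prod>k<K. fst \<tau> i k) * \<theta> i
     + (\<Sum>l\<in>stable_idx lam - {i}. coupling_term \<tau> \<theta> K i l)
     + (\<Sum>l\<in>unstable_idx lam - {i}. coupling_term \<tau> \<theta> K i l)"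

definition eps_traj ::
  "real \<Rightarrow> ('n \<Rightarrow> real) \<Rightarrow> ('n \<Rightarrow> real^'n) \<Rightarrow> ('n \<Rightarrow> real) \<Rightarrow> 'n coeffs \<Rightarrow> nat \<Rightarrow> real^'n" where
  "eps_traj \<epsilon> lam v \<theta> \<tau> K =
     \<epsilon> *\<^sub>R (\<Sum>i\<in>stable_idx lam. traj_coord lam \<tau> \<theta> K i *\<^sub>R v i)
     + \<epsilon> *\<^sub>R (\<Sum>j\<in>unstable_idx lam. traj_coord lam \<tau> \<theta> K j *\<^sub>R v j)"

definition admissible ::
  "('n \<Rightarrow> real) \<Rightarrow> real \<Rightarrow> real \<Rightarrow> real \<Rightarrow> real \<Rightarrow> real \<Rightarrow> 'n coeffs set" where
  "admissible lam s_lo s_hi us_lo us_hi d_bd = {(c, d).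
     (\<forall>i\<in>stable_idx lam. \<forall>k. s_lo \<le> c i k \<and> c i k \<le> s_hi) \<and>
     (\<forall>j\<in>unstable_idx lam. \<forall>k. us_lo \<le> c j k \<and> c j k \<le> us_hi) \<and>
     (\<forall>i l k. i \<noteq> l \<longrightarrow> \<bar>d i l k\<bar> \<le> d_bd)}"

text \<open>In \<open>enat\<close>, the infimum of the empty set is \<open>\<infinity>\<close> (no exit).\<close>
definition exit_time ::
  "real \<Rightarrow> ('n \<Rightarrow> real) \<Rightarrow> ('n \<Rightarrow> real^'n) \<Rightarrow> ('n \<Rightarrow> real) \<Rightarrow> 'n coeffs \<Rightarrow> enat" where
  "exit_time \<epsilon> lam v \<theta> \<tau> =
     Inf {enat K | K. K \<ge> 1 \<and> (norm (eps_traj \<epsilon> lam v \<theta> \<tau> K))\<^sup>2 > \<epsilon>\<^sup>2}"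

definition traj_fun ::
  "real \<Rightarrow> real \<Rightarrow> real \<Rightarrow> real \<Rightarrow> real \<Rightarrow> (nat \<Rightarrow> real) \<Rightarrow> real \<Rightarrow> real \<Rightarrow> nat \<Rightarrow> real" where
  "traj_fun c1 c2 c3 c4 b1 b2 \<Theta>s \<Theta>us K =
     (c1 ^ (2*K) - 2 * real K * c2 ^ (2*K - 1) * b1
        - b2 K * c3 ^ K * c2 ^ K - b2 K * c3 ^ (2*K)) * \<Theta>s
     + (c4 ^ (2*K) - 2 * real K * c3 ^ (2*K - 1) * b1
        - b2 K * c3 ^ K * c2 ^ K - b2 K * c3 ^ (2*K)) * \<Theta>us"

text \<open>
  Rendering of the Landau symbols in the theorem about these notions.  A term \<open>\<O>(\<epsilon>\<^sup>2)\<close> in the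
  data (the coefficient intervals, the thresholds on \<open>\<epsilon>\<close> and on \<open>\<alpha>\<close>) is an arbitrary real
  number bounded by \<open>C * \<epsilon>\<^sup>2\<close> (by \<open>C * \<epsilon>\<close> for \<open>\<O>(\<epsilon>)\<close>), with \<open>C\<close> given in
  advance; those in the coefficient intervals are nonnegative, as they enlarge the intervals.
  The constants \<open>\<eta>\<close> (for \<open>K \<epsilon> \<lless> 1\<close>) and \<open>C'\<close> (for the \<open>\<O>\<close>-terms that occur only in
  the conclusion) depend on \<open>n, L, M, \<beta>, a, \<kappa>, C\<close> alone, so they are uniform in
  \<open>f, x\<^sup>*, \<alpha>, \<delta>, \<epsilon>\<close> and the initial point.  Since \<open>K \<ge> 1\<close>, the condition
  \<open>K \<epsilon> \<le> \<eta>\<close> includes the smallness of \<open>\<epsilon>\<close>.  The error in the denominator of \<open>b\<^sub>2\<close> is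
  nonnegative, which excludes that the denominator vanishes when \<open>\<alpha>\<close> is itself of order
  \<open>\<epsilon>\<^sup>2\<close>.\<close>

end

theory Submission
  imports Defs
begin

text \<open>
  In the basis \<open>v\<close> each coordinate is \<open>P\<^sub>i \<theta>\<^sub>i + R\<^sub>i\<close>, with \<open>P\<^sub>i\<close> a product of diagonal
  coefficients and \<open>R\<^sub>i\<close> the coupling terms, so its square is at least
  \<open>P\<^sub>i\<^sup>2 \<theta>\<^sub>i\<^sup>2 - 2 \<bar>P\<^sub>i \<theta>\<^sub>i R\<^sub>i\<bar>\<close>.  Couplings inside the stable or the unstable block give the
  \<open>b\<^sub>1\<close> terms; couplings between the blocks give the geometric sums
  \<open>\<Sum>r<K. c\<^sub>2\<^sup>r c\<^sub>3\<^sup>K\<^sup>-\<^sup>1\<^sup>-\<^sup>r\<close>, bounded by \<open>c\<^sub>3\<^sup>K (1 + O(K\<epsilon>)) / (\<alpha>L + \<alpha>\<beta>)\<close>, hence the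
  \<open>b\<^sub>2\<close> terms.  As both blocks are nonempty, the cross sum of the \<open>\<theta>\<^sub>i \<theta>\<^sub>l\<close> is bounded with the
  factor \<open>n - 1\<close> instead of \<open>n\<close>; the difference is a gap of order \<open>\<epsilon>\<close>, uniform in
  \<open>\<tau>\<close> and \<open>K\<close>.  It makes the inequality for the infimum strict and absorbs \<open>c\<^sub>1\<^sup>2\<^sup>K\<close>
  when \<open>c\<^sub>1 < 0\<close>, since then \<open>c\<^sub>1 = O(\<epsilon>)\<close>.
\<close>

section \<open>Eigenvalues of the Hessian and orthonormal expansions\<close>

text \<open>A small step from \<open>x\<close> along the unit eigenvector \<open>w\<close> changes
  the gradient by \<open>lam\<close> times that step, up to an error of \<open>e\<close> times its
  length. The Lipschitz condition limits this change, which yields \<open>L + e\<close> for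
  arbitrary \<open>e\<close>.\<close>

lemma abs_eigenvalue_hess_le:
  fixes f :: "real^'n \<Rightarrow> real"
  assumes diff: "grad f differentiable (at x)"
    and lip: "\<And>x y. norm (grad f x - grad f y) \<le> L * norm (x - y)"
    and eig: "hess f x *v w = lam *\<^sub>R w" and w: "norm w = 1"
  shows "\<bar>lam\<bar> \<le> L"
proof (rule field_le_epsilon)
  fix e :: real assume e: "e > 0"
  have "(grad f has_derivative (\<lambda>h. hess f x *v h)) (at x)"
    using diff by (simp add: hess_def jacobian_works)
  then obtain d where d: "d > 0"
    "\<And>y. norm (y - x) < d \<Longrightarrow>
      norm (grad f y - grad f x - hess f x *v (y - x)) \<le> e * norm (y - x)"
    using e unfolding has_derivative_at_alt by blast
  \<comment> \<open>Half of \<open>d\<close> keeps \<open>y\<close> strictly inside the ball on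
    which the derivative estimate holds.\<close>
  define y where "y = x + (d / 2) *\<^sub>R w"
  have ny: "norm (y - x) = d / 2" using d w by (simp add: y_def)
  have Hy: "hess f x *v (y - x) = (d / 2 * lam) *\<^sub>R w"
    by (simp add: y_def matrix_vector_mult_scaleR eig)
  have "norm (hess f x *v (y - x))
      \<le> norm (grad f y - grad f x) + norm (grad f y - grad f x - hess f x *v (y - x))"
    by (metis norm_triangle_sub norm_minus_commute)
  also have "\<dots> \<le> L * (d / 2) + e * (d / 2)"
    using lip[of y x] d(2)[of y] ny d(1) by (intro add_mono) auto
  finally have "(d / 2) * \<bar>lam\<bar> \<le> (d / 2) * (L + e)"
    unfolding Hy using w d(1) by (simp add: abs_mult algebra_simps)
  then show "\<bar>lam\<bar> \<le> L + e" using d(1) by simp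
qed

text \<open>With the vectors as rows of \<open>V\<close>, orthonormality makes the transpose a right
  inverse. For a square matrix it is then also a left inverse, and this is completeness of the
  system.\<close>

lemma orthonormal_expansion:
  fixes v :: "'n::finite \<Rightarrow> real^'n"
  assumes "\<And>i l. v i \<bullet> v l = (if i = l then 1 else 0)"
  shows "(\<Sum>i\<in>UNIV. (x \<bullet> v i) *\<^sub>R v i) = x"
proof -
  define V :: "real^'n^'n" where "V = (\<chi> i. v i)"
  have "V ** transpose V = mat 1"
    using assms by (simp add: V_def matrix_matrix_mult_def transpose_def mat_def vec_eq_iff inner_vec_def)
  then have "transpose V ** V = mat 1"
    using matrix_left_right_inverse by blast
  then have "transpose V *v (V *v x) = x"
    by (simp add: matrix_vector_mul_assoc)
  moreover have "transpose V *v (V *v x) = (\<Sum>i\<in>UNIV. (x \<bullet> v i) *\<^sub>R v i)"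
    by (simp add: matrix_mult_sum V_def matrix_vector_mult_def inner_vec_def mult.commute
        column_def transpose_def vec_eq_iff)
  ultimately show ?thesis by simp
qed

lemma norm_sum_orthonormal:
  fixes v :: "'n::finite \<Rightarrow> 'a::real_inner"
  assumes "\<And>i l. v i \<bullet> v l = (if i = l then 1 else 0)"
  shows "(norm (\<Sum>i\<in>UNIV. a i *\<^sub>R v i))\<^sup>2 = (\<Sum>i\<in>UNIV. (a i)\<^sup>2)"
  unfolding power2_norm_eq_inner inner_sum_left inner_sum_right
  by (simp add: assms power2_eq_square if_distrib cong: if_cong)

text \<open>An eigenvector has a nonzero component along some \<open>v l\<close>, and computing that
  component of \<open>A *v x\<close> in two ways identifies \<open>\<mu>\<close> with
  \<open>lam l\<close>. This turns the positive and negative eigenvalues at a strict saddle into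
  stable and unstable indices.\<close>

lemma eigenvalue_mem_range:
  assumes op: "orthonormal_eigenpairs A lam v" and ev: "is_eigenvalue A \<mu>"
  shows "\<mu> \<in> range lam"
proof -
  have on: "\<And>i l. v i \<bullet> v l = (if i = l then 1 else 0)" and ei: "\<And>i. A *v v i = lam i *\<^sub>R v i"
    using op by (auto simp: orthonormal_eigenpairs_def)
  obtain x where x: "x \<noteq> 0" "A *v x = \<mu> *\<^sub>R x" using ev by (auto simp: is_eigenvalue_def)
  obtain l where l: "x \<bullet> v l \<noteq> 0"
  proof (rule ccontr)
    assume "\<not> thesis"
    then have "\<And>l. x \<bullet> v l = 0" using that by blast
    then show False using orthonormal_expansion[OF on, of x] x(1) by simp
  qed
  have "A *v x = A *v (\<Sum>i\<in>UNIV. (x \<bullet> v i) *\<^sub>R v i)"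
    by (simp only: orthonormal_expansion[OF on])
  also have "\<dots> = (\<Sum>i\<in>UNIV. (x \<bullet> v i) *\<^sub>R (lam i *\<^sub>R v i))"
    by (simp only: linear_sum[OF matrix_vector_mul_linear] matrix_vector_mult_scaleR ei)
  finally have "(A *v x) \<bullet> v l = (x \<bullet> v l) * lam l"
    by (simp add: inner_sum_left on if_distrib cong: if_cong)
  then have "\<mu> = lam l" using l x(2) by simp
  then show ?thesis by simp
qed

section \<open>Coupling terms and a lower bound for the squared coordinates\<close>

text \<open>Summand \<open>r\<close> carries \<open>r\<close> diagonal factors of index
  \<open>i\<close> and, since position \<open>r\<close> itself is taken by \<open>d\<close>, only
  \<open>K - Suc r\<close> factors of index \<open>l\<close>.\<close>

lemma abs_coupling_term_le:
  assumes "\<And>k. \<bar>c i k\<bar> \<le> p" "\<And>k. \<bar>c l k\<bar> \<le> q" "\<And>k. \<bar>d i l k\<bar> \<le> D" "\<theta> l \<ge> 0"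
  shows "\<bar>coupling_term (c, d) \<theta> K i l\<bar> \<le> D * (\<Sum>r<K. p ^ r * q ^ (K - Suc r)) * \<theta> l"
proof -
  have p: "p \<ge> 0" and q: "q \<ge> 0" and D: "D \<ge> 0"
    using assms(1-3)[of 0] by linarith+
  have "\<bar>(\<Prod>k<r. c i k) * d i l r * (\<Prod>k\<in>{r<..<K}. c l k) * \<theta> l\<bar>
      \<le> p ^ r * D * q ^ (K - Suc r) * \<theta> l" for r
  proof -
    have "(\<Prod>k<r. \<bar>c i k\<bar>) \<le> p ^ r"
      using prod_mono[of "{..<r}" "\<lambda>k. \<bar>c i k\<bar>" "\<lambda>_. p"] assms(1) by simp
    moreover have "(\<Prod>k\<in>{r<..<K}. \<bar>c l k\<bar>) \<le> q ^ (K - Suc r)"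
      using prod_mono[of "{r<..<K}" "\<lambda>k. \<bar>c l k\<bar>" "\<lambda>_. q"] assms(2) by simp
    ultimately show ?thesis
      unfolding abs_mult abs_prod using assms(3,4) p q D
      by (intro mult_mono) (auto intro!: mult_nonneg_nonneg prod_nonneg)
  qed
  then have "\<bar>coupling_term (c, d) \<theta> K i l\<bar> \<le> (\<Sum>r<K. p ^ r * D * q ^ (K - Suc r) * \<theta> l)"
    unfolding coupling_term_def by (auto intro!: order_trans[OF sum_abs] sum_mono)
  also have "\<dots> = D * (\<Sum>r<K. p ^ r * q ^ (K - Suc r)) * \<theta> l"
    by (simp add: sum_distrib_left sum_distrib_right mult_ac)
  finally show ?thesis .
qed

text \<open>The inequality \<open>2xy \<le> x^2 + y^2\<close> is applied to every pair. Each sum of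
  squares is weighted by the size of the other set, so two different blocks get weights below the
  dimension.\<close>

lemma sum_product_le_sum_squares:
  fixes \<theta> :: "'a \<Rightarrow> real"
  shows "2 * (sum \<theta> A * sum \<theta> B)
    \<le> real (card B) * (\<Sum>i\<in>A. (\<theta> i)\<^sup>2) + real (card A) * (\<Sum>l\<in>B. (\<theta> l)\<^sup>2)"
proof -
  have "2 * (sum \<theta> A * sum \<theta> B) = (\<Sum>i\<in>A. \<Sum>l\<in>B. 2 * (\<theta> i * \<theta> l))"
    unfolding sum_product by (simp add: sum_distrib_left)
  also have "\<dots> \<le> (\<Sum>i\<in>A. \<Sum>l\<in>B. (\<theta> i)\<^sup>2 + (\<theta> l)\<^sup>2)"
    using sum_squares_bound by (intro sum_mono) (simp add: mult.assoc)
  also have "\<dots> = real (card B) * (\<Sum>i\<in>A. (\<theta> i)\<^sup>2) + real (card A) * (\<Sum>l\<in>B. (\<theta> l)\<^sup>2)"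
    by (simp add: sum.distrib sum_distrib_left)
  finally show ?thesis .
qed

text \<open>Each coordinate is a diagonal part plus couplings; the square of the couplings is
  dropped and the mixed product is bounded from below. \<open>W\<close> stays abstract, so that
  exchanging \<open>p\<close> and \<open>q\<close> turns the estimate for the stable block into that
  for the unstable one.\<close>

lemma sum_squares_block_ge:
  fixes c :: "'n::finite \<Rightarrow> nat \<Rightarrow> real" and \<theta> t :: "'n \<Rightarrow> real"
  assumes cI: "\<And>i k. i \<in> I \<Longrightarrow> \<bar>c i k\<bar> \<le> p" and cJ: "\<And>i k. i \<in> J \<Longrightarrow> \<bar>c i k\<bar> \<le> q"
    and d: "\<And>i l k. i \<noteq> l \<Longrightarrow> \<bar>d i l k\<bar> \<le> D" and D: "D \<ge> 0" and \<theta>: "\<And>i. \<theta> i \<ge> 0"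
    and p: "p \<ge> 0"
    and W: "(\<Sum>r<K. p ^ r * q ^ (K - Suc r)) \<le> W" "W \<ge> 0" and K: "K \<ge> 1"
    and A: "\<And>i. i \<in> I \<Longrightarrow> A \<le> (\<Prod>k<K. c i k)\<^sup>2"
    and t: "\<And>i. i \<in> I \<Longrightarrow> t i = (\<Prod>k<K. c i k) * \<theta> i
        + (\<Sum>l\<in>I - {i}. coupling_term (c, d) \<theta> K i l)
        + (\<Sum>l\<in>J - {i}. coupling_term (c, d) \<theta> K i l)"
  shows "A * (\<Sum>i\<in>I. (\<theta> i)\<^sup>2) - 2 * real K * p ^ (2 * K - 1) * D * (sum \<theta> I * sum \<theta> I)
      - 2 * D * W * p ^ K * (sum \<theta> I * sum \<theta> J) \<le> (\<Sum>i\<in>I. (t i)\<^sup>2)"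
proof -
  let ?X = "D * (real K * p ^ (K - 1)) * sum \<theta> I + D * W * sum \<theta> J"
  have "A * (\<theta> i)\<^sup>2 - 2 * p ^ K * ?X * \<theta> i \<le> (t i)\<^sup>2" if i: "i \<in> I" for i
  proof -
    let ?P = "\<Prod>k<K. c i k"
    let ?RI = "\<Sum>l\<in>I - {i}. coupling_term (c, d) \<theta> K i l"
    let ?RJ = "\<Sum>l\<in>J - {i}. coupling_term (c, d) \<theta> K i l"
    \<comment> \<open>Inside one block all \<open>K\<close> summands have the same total exponent
      \<open>K - 1\<close>.\<close>
    have pp: "(\<Sum>r<K. p ^ r * p ^ (K - Suc r)) = real K * p ^ (K - 1)"
      by (simp flip: power_add)
    have "\<bar>?RI\<bar> \<le> (\<Sum>l\<in>I - {i}. D * (real K * p ^ (K - 1)) * \<theta> l)"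
      using abs_coupling_term_le[of c i p _ p d D \<theta> K] cI[OF i] cI d \<theta> pp
      by (intro order_trans[OF sum_abs] sum_mono) auto
    also have "\<dots> \<le> (\<Sum>l\<in>I. D * (real K * p ^ (K - 1)) * \<theta> l)"
      using D p \<theta> by (intro sum_mono2) auto
    finally have RI: "\<bar>?RI\<bar> \<le> D * (real K * p ^ (K - 1)) * sum \<theta> I"
      by (simp add: sum_distrib_left)
    have "\<bar>?RJ\<bar> \<le> (\<Sum>l\<in>J - {i}. D * W * \<theta> l)"
    proof (intro order_trans[OF sum_abs] sum_mono)
      fix l assume l: "l \<in> J - {i}"
      have "\<bar>coupling_term (c, d) \<theta> K i l\<bar> \<le> D * (\<Sum>r<K. p ^ r * q ^ (K - Suc r)) * \<theta> l"
        using l by (intro abs_coupling_term_le cI[OF i] cJ d \<theta>) auto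
      also have "\<dots> \<le> D * W * \<theta> l"
        using D \<theta> W by (intro mult_right_mono mult_left_mono) auto
      finally show "\<bar>coupling_term (c, d) \<theta> K i l\<bar> \<le> D * W * \<theta> l" .
    qed
    also have "\<dots> \<le> (\<Sum>l\<in>J. D * W * \<theta> l)"
      using D W \<theta> by (intro sum_mono2) auto
    finally have RJ: "\<bar>?RJ\<bar> \<le> D * W * sum \<theta> J"
      by (simp add: sum_distrib_left)
    have R: "\<bar>?RI + ?RJ\<bar> \<le> ?X" using RI RJ by linarith
    have P: "\<bar>?P\<bar> \<le> p ^ K"
      using prod_mono[of "{..<K}" "\<lambda>k. \<bar>c i k\<bar>" "\<lambda>_. p"] cI[OF i] by (simp add: abs_prod)
    have "\<bar>?P * \<theta> i * (?RI + ?RJ)\<bar> \<le> p ^ K * \<theta> i * ?X"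
      unfolding abs_mult using P R \<theta>[of i] p by (intro mult_mono) auto
    then have "- (p ^ K * \<theta> i * ?X) \<le> ?P * \<theta> i * (?RI + ?RJ)" by linarith
    moreover have "A * (\<theta> i)\<^sup>2 \<le> ?P\<^sup>2 * (\<theta> i)\<^sup>2"
      using A[OF i] by (intro mult_right_mono) auto
    moreover have "(t i)\<^sup>2 = ?P\<^sup>2 * (\<theta> i)\<^sup>2 + 2 * (?P * \<theta> i * (?RI + ?RJ)) + (?RI + ?RJ)\<^sup>2"
      unfolding t[OF i] by algebra
    moreover have "(?RI + ?RJ)\<^sup>2 \<ge> 0" by simp
    ultimately show ?thesis by (simp only: mult_ac)
  qed
  then have "(\<Sum>i\<in>I. A * (\<theta> i)\<^sup>2 - 2 * p ^ K * ?X * \<theta> i) \<le> (\<Sum>i\<in>I. (t i)\<^sup>2)"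
    by (rule sum_mono)
  moreover have "(\<Sum>i\<in>I. A * (\<theta> i)\<^sup>2 - 2 * p ^ K * ?X * \<theta> i)
      = A * (\<Sum>i\<in>I. (\<theta> i)\<^sup>2) - 2 * p ^ K * ?X * sum \<theta> I"
    by (simp only: sum_subtractf sum_distrib_left)
  moreover have "p ^ (2 * K - 1) = p ^ K * p ^ (K - 1)"
    using K by (simp flip: power_add add: mult_2)
  ultimately show ?thesis by (simp add: algebra_simps)
qed

lemma power_convolution_commute:
  fixes p q :: "'a::comm_semiring_1"
  shows "(\<Sum>r<K. p ^ r * q ^ (K - Suc r)) = (\<Sum>r<K. q ^ r * p ^ (K - Suc r))"
  by (subst sum.nat_diff_reindex[symmetric]) (auto intro!: sum.cong simp: mult.commute)

text \<open>The estimates of the two blocks are added. They share the cross product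
  \<open>sum \<theta> S * sum \<theta> U\<close>, weighted by \<open>p ^ K\<close> and
  \<open>q ^ K\<close>, and by symmetry of the convolution they share \<open>W\<close>.\<close>

lemma sum_squares_traj_coord_ge:
  fixes lam \<theta> :: "'n::finite \<Rightarrow> real" and c :: "'n \<Rightarrow> nat \<Rightarrow> real"
  defines "S \<equiv> stable_idx lam" and "U \<equiv> unstable_idx lam" and "n \<equiv> real CARD('n)"
  assumes SU: "S \<union> U = UNIV" "S \<noteq> {}" "U \<noteq> {}"
    and cS: "\<And>i k. i \<in> S \<Longrightarrow> \<bar>c i k\<bar> \<le> p" and cU: "\<And>i k. i \<in> U \<Longrightarrow> \<bar>c i k\<bar> \<le> q"
    and d: "\<And>i l k. i \<noteq> l \<Longrightarrow> \<bar>d i l k\<bar> \<le> D" and D: "D \<ge> 0" and \<theta>: "\<And>i. \<theta> i \<ge> 0"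
    and \<theta>1: "(\<Sum>i\<in>S. (\<theta> i)\<^sup>2) + (\<Sum>j\<in>U. (\<theta> j)\<^sup>2) = 1"
    and p: "p \<ge> 0" and q: "q \<ge> 0"
    and W: "(\<Sum>r<K. p ^ r * q ^ (K - Suc r)) \<le> W" and K: "K \<ge> 1"
    and A: "\<And>i. i \<in> S \<Longrightarrow> A \<le> (\<Prod>k<K. c i k)\<^sup>2"
    and B: "\<And>i. i \<in> U \<Longrightarrow> B \<le> (\<Prod>k<K. c i k)\<^sup>2"
  shows "(A - 2 * real K * p ^ (2 * K - 1) * (n * D)) * (\<Sum>i\<in>S. (\<theta> i)\<^sup>2)
      + (B - 2 * real K * q ^ (2 * K - 1) * (n * D)) * (\<Sum>j\<in>U. (\<theta> j)\<^sup>2)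
      - (n - 1) * D * W * (p ^ K + q ^ K)
    \<le> (\<Sum>i\<in>UNIV. (traj_coord lam (c, d) \<theta> K i)\<^sup>2)"
proof -
  let ?s = "\<Sum>i\<in>S. (\<theta> i)\<^sup>2" and ?u = "\<Sum>j\<in>U. (\<theta> j)\<^sup>2"
  let ?t = "traj_coord lam (c, d) \<theta> K"
  have W': "(\<Sum>r<K. q ^ r * p ^ (K - Suc r)) \<le> W"
    using W by (simp only: power_convolution_commute)
  have "0 \<le> (\<Sum>r<K. p ^ r * q ^ (K - Suc r))"
    using p q by (intro sum_nonneg) auto
  then have W0: "W \<ge> 0" using W by linarith
  have disj: "S \<inter> U = {}" by (auto simp: S_def U_def stable_idx_def unstable_idx_def)
  have cards: "real (card S) + real (card U) = n"
    using card_Un_disjoint[of S U] disj SU(1) by (simp add: n_def)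
  have card1: "real (card S) \<ge> 1" "real (card U) \<ge> 1"
    using SU by (simp_all add: Suc_le_eq card_gt_0_iff)
  have nn: "?s \<ge> 0" "?u \<ge> 0" by (simp_all add: sum_nonneg)
  have SS: "sum \<theta> S * sum \<theta> S \<le> n * ?s"
    using sum_product_le_sum_squares[of \<theta> S S] mult_right_mono[of "real (card S)" n ?s] nn cards
    by simp
  have UU: "sum \<theta> U * sum \<theta> U \<le> n * ?u"
    using sum_product_le_sum_squares[of \<theta> U U] mult_right_mono[of "real (card U)" n ?u] nn cards
    by simp
  have "2 * (sum \<theta> S * sum \<theta> U) \<le> real (card U) * ?s + real (card S) * ?u"
    by (rule sum_product_le_sum_squares)
  \<comment> \<open>Neither block is empty, so each has at most \<open>n - 1\<close> elements; the
    unit saved here is the source of the strict inequality.\<close>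
  also have "\<dots> \<le> (n - 1) * ?s + (n - 1) * ?u"
    using cards card1 nn by (intro add_mono mult_right_mono) auto
  also have "\<dots> = n - 1" using \<theta>1 by (simp flip: distrib_left)
  finally have SUb: "2 * (sum \<theta> S * sum \<theta> U) \<le> n - 1" .
  have "A * ?s - 2 * real K * p ^ (2 * K - 1) * D * (sum \<theta> S * sum \<theta> S)
      - 2 * D * W * p ^ K * (sum \<theta> S * sum \<theta> U) \<le> (\<Sum>i\<in>S. (?t i)\<^sup>2)"
    by (rule sum_squares_block_ge[where c = c and d = d and q = q])
      (use cS cU d D \<theta> p W W0 K A in \<open>auto simp: traj_coord_def S_def U_def\<close>)
  moreover have "B * ?u - 2 * real K * q ^ (2 * K - 1) * D * (sum \<theta> U * sum \<theta> U)
      - 2 * D * W * q ^ K * (sum \<theta> U * sum \<theta> S) \<le> (\<Sum>i\<in>U. (?t i)\<^sup>2)"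
    by (rule sum_squares_block_ge[where c = c and d = d and q = p])
      (use cS cU d D \<theta> q W' W0 K B in \<open>auto simp: traj_coord_def S_def U_def\<close>)
  moreover have "(\<Sum>i\<in>UNIV. (?t i)\<^sup>2) = (\<Sum>i\<in>S. (?t i)\<^sup>2) + (\<Sum>i\<in>U. (?t i)\<^sup>2)"
    using sum.union_disjoint[of S U] disj SU(1) by simp
  moreover have "2 * real K * p ^ (2 * K - 1) * D * (sum \<theta> S * sum \<theta> S)
      \<le> 2 * real K * p ^ (2 * K - 1) * D * (n * ?s)"
    using SS p D by (intro mult_left_mono) auto
  moreover have "2 * real K * q ^ (2 * K - 1) * D * (sum \<theta> U * sum \<theta> U)
      \<le> 2 * real K * q ^ (2 * K - 1) * D * (n * ?u)"
    using UU q D by (intro mult_left_mono) auto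
  moreover have "D * W * (p ^ K + q ^ K) * (2 * (sum \<theta> S * sum \<theta> U))
      \<le> D * W * (p ^ K + q ^ K) * (n - 1)"
    using SUb p q D W0 by (intro mult_left_mono) auto
  ultimately show ?thesis by (simp add: algebra_simps)
qed

text \<open>The slack \<open>r\<close> compensates for \<open>q - p\<close> being smaller than \<open>s\<close>, at the cost of the factor
  \<open>(1 + r)\<^sup>K \<le> 1 + 2 K r\<close>.\<close>
lemma geometric_convolution_le:
  fixes p q s r :: real
  assumes "0 \<le> p" "1 \<le> q" "0 < s" "0 \<le> r" "s \<le> q + r - p" "real K * r \<le> 1"
  shows "(\<Sum>k<K. p ^ k * q ^ (K - Suc k)) \<le> q ^ K * (1 + 2 * (real K * r)) / s"
proof -
  have "(\<Sum>k<K. p ^ k * q ^ (K - Suc k)) \<le> (\<Sum>k<K. p ^ k * (q + r) ^ (K - Suc k))"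
    using assms by (intro sum_mono mult_left_mono power_mono) auto
  also have "\<dots> = ((q + r) ^ K - p ^ K) / (q + r - p)"
    using assms power_diff_sumr2[of p K "q + r"] by (simp add: field_simps)
  also have "\<dots> \<le> (q + r) ^ K / s"
    using assms by (intro frac_le) auto
  \<comment> \<open>As \<open>q \<ge> 1\<close>, \<open>q + r \<le> q * (1 + r)\<close>, which
    separates the factor \<open>q ^ K\<close>.\<close>
  also have "\<dots> \<le> (q * (1 + r)) ^ K / s"
    using assms by (intro divide_right_mono power_mono) (auto simp: algebra_simps mult_le_cancel_right1)
  also have "\<dots> \<le> q ^ K * exp (real K * r) / s"
    unfolding power_mult_distrib exp_of_nat_mult using assms
    by (intro divide_right_mono mult_left_mono power_mono) (auto simp: exp_ge_add_one_self)
  also have "exp (real K * r) \<le> 1 + 2 * (real K * r)"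
    using exp_bound[of "real K * r"] assms
    by (smt (verit) mult_nonneg_nonneg of_nat_0_le_iff mult_left_le power2_eq_square)
  finally show ?thesis using assms by (simp add: divide_right_mono mult_left_mono)
qed

section \<open>The trajectory function with a uniform surplus\<close>

text \<open>\<open>traj_fun\<close> uses the factor \<open>n\<close> where the estimate has
  \<open>n - 1\<close>. The difference \<open>D * W * (c2 ^ K + c3 ^ K)\<close> is at least
  \<open>D / s\<close>, because \<open>c3 \<ge> 1\<close> gives \<open>W \<ge> 1 / s\<close>. The
  loss \<open>z\<close> pays for a negative \<open>c1\<close>.\<close>

lemma traj_fun_gap:
  fixes lam \<theta> :: "'n::finite \<Rightarrow> real"
  defines "S \<equiv> stable_idx lam" and "U \<equiv> unstable_idx lam" and "n \<equiv> real CARD('n)"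
  assumes SU: "S \<union> U = UNIV" "S \<noteq> {}" "U \<noteq> {}"
    and \<tau>: "\<tau> \<in> admissible lam c1 c2 c4 c3 D" and \<theta>: "\<And>i. \<theta> i \<ge> 0"
    and \<theta>1: "(\<Sum>i\<in>S. (\<theta> i)\<^sup>2) + (\<Sum>j\<in>U. (\<theta> j)\<^sup>2) = 1"
    and D: "D \<ge> 0" and c: "0 \<le> c2" "- c1 \<le> c2" "1 \<le> c3" "0 \<le> c4"
    and s: "0 < s" and r: "0 \<le> r" "s \<le> c3 + r - c2" "real K * r \<le> 1" "2 * (real K * r) \<le> \<omega> K"
    and K: "K \<ge> 1" and z: "0 \<le> z" "c1 < 0 \<Longrightarrow> c1\<^sup>2 \<le> z" "z \<le> 1"
  shows "traj_fun c1 c2 c3 c4 (n * D) (\<lambda>K. n * D * (1 + \<omega> K) / s)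
      (\<Sum>i\<in>S. (\<theta> i)\<^sup>2) (\<Sum>j\<in>U. (\<theta> j)\<^sup>2) K + (D / s - z)
    \<le> (\<Sum>i\<in>UNIV. (traj_coord lam \<tau> \<theta> K i)\<^sup>2)"
proof -
  obtain a d where \<tau>_eq: "\<tau> = (a, d)" by (cases \<tau>)
  let ?s = "\<Sum>i\<in>S. (\<theta> i)\<^sup>2" and ?u = "\<Sum>j\<in>U. (\<theta> j)\<^sup>2"
  have aS: "c1 \<le> a i k" "a i k \<le> c2" if "i \<in> S" for i k
    using \<tau> that by (auto simp: \<tau>_eq admissible_def S_def)
  have aU: "c4 \<le> a i k" "a i k \<le> c3" if "i \<in> U" for i k
    using \<tau> that by (auto simp: \<tau>_eq admissible_def U_def)
  have d: "\<bar>d i l k\<bar> \<le> D" if "i \<noteq> l" for i l k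
    using \<tau> that by (auto simp: \<tau>_eq admissible_def)
  define W where "W = c3 ^ K * (1 + \<omega> K) / s"
  have \<omega>0: "\<omega> K \<ge> 0" using r by (smt (verit) mult_nonneg_nonneg of_nat_0_le_iff)
  have conv: "(\<Sum>k<K. c2 ^ k * c3 ^ (K - Suc k)) \<le> W"
  proof -
    have "(\<Sum>k<K. c2 ^ k * c3 ^ (K - Suc k)) \<le> c3 ^ K * (1 + 2 * (real K * r)) / s"
      using c s r by (intro geometric_convolution_le) auto
    also have "\<dots> \<le> W"
      unfolding W_def using c s r by (intro divide_right_mono mult_left_mono) auto
    finally show ?thesis .
  qed
  have A: "c1 ^ (2 * K) - z \<le> (\<Prod>k<K. a i k)\<^sup>2" if "i \<in> S" for i
  proof (cases "c1 < 0")
    case False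
    then have "c1 ^ K \<le> (\<Prod>k<K. a i k)"
      using prod_mono[of "{..<K}" "\<lambda>_. c1" "a i"] aS[OF that] by simp
    then have "(c1 ^ K)\<^sup>2 \<le> (\<Prod>k<K. a i k)\<^sup>2"
      using False by (intro power_mono) auto
    then show ?thesis using z by (simp add: power_mult mult.commute flip: power_mult)
  next
    \<comment> \<open>The diagonal factors may now vanish or change sign, so only nonnegativity of
      the square is available; \<open>c1 ^ (2 * K)\<close> is at most \<open>z\<close>, and the left
      side is at most zero.\<close>
    case True
    have "(c1\<^sup>2) ^ K \<le> (c1\<^sup>2) ^ 1"
      using K z True by (intro power_decreasing) auto
    then have "c1 ^ (2 * K) \<le> z" using z(2)[OF True] by (simp add: power_mult)
    then show ?thesis by (smt (verit) zero_le_power2)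
  qed
  have B: "c4 ^ (2 * K) \<le> (\<Prod>k<K. a i k)\<^sup>2" if "i \<in> U" for i
  proof -
    have "c4 ^ K \<le> (\<Prod>k<K. a i k)"
      using prod_mono[of "{..<K}" "\<lambda>_. c4" "a i"] aU[OF that] c by simp
    then have "(c4 ^ K)\<^sup>2 \<le> (\<Prod>k<K. a i k)\<^sup>2"
      using c by (intro power_mono) auto
    then show ?thesis by (simp add: mult.commute flip: power_mult)
  qed
  have "(c1 ^ (2 * K) - z - 2 * real K * c2 ^ (2 * K - 1) * (n * D)) * ?s
      + (c4 ^ (2 * K) - 2 * real K * c3 ^ (2 * K - 1) * (n * D)) * ?u
      - (n - 1) * D * W * (c2 ^ K + c3 ^ K)
    \<le> (\<Sum>i\<in>UNIV. (traj_coord lam \<tau> \<theta> K i)\<^sup>2)"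
    unfolding \<tau>_eq S_def U_def n_def
  proof (rule sum_squares_traj_coord_ge)
    show "\<bar>a i k\<bar> \<le> c2" if "i \<in> stable_idx lam" for i k
      using aS[of i k] c that by (auto simp: S_def abs_le_iff)
    show "\<bar>a i k\<bar> \<le> c3" if "i \<in> unstable_idx lam" for i k
      using aU[of i k] c that by (auto simp: U_def abs_le_iff)
  qed (use SU d D \<theta> \<theta>1 c conv K A B in \<open>auto simp: S_def U_def\<close>)
  moreover have "D / s \<le> D * W * (c2 ^ K + c3 ^ K)"
  proof -
    have "1 * 1 \<le> c3 ^ K * (1 + \<omega> K)" using c \<omega>0 by (intro mult_mono) auto
    then have "1 / s \<le> W" unfolding W_def using s by (intro divide_right_mono) auto
    moreover have "1 \<le> c2 ^ K + c3 ^ K"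
      using c one_le_power[of c3 K] zero_le_power[of c2 K] by linarith
    ultimately have "1 / s * 1 \<le> W * (c2 ^ K + c3 ^ K)"
      using s by (intro mult_mono) (auto intro: order_trans[of 0 "1/s"])
    from mult_left_mono[OF this D] show ?thesis by (simp add: mult.assoc)
  qed
  moreover have "z * ?s \<le> z"
    using \<theta>1 z sum_nonneg[of U "\<lambda>j. (\<theta> j)\<^sup>2"] by (intro mult_left_le) auto
  moreover have "traj_fun c1 c2 c3 c4 (n * D) (\<lambda>K. n * D * (1 + \<omega> K) / s) ?s ?u K
      = (c1 ^ (2 * K) - 2 * real K * c2 ^ (2 * K - 1) * (n * D)) * ?s
        + (c4 ^ (2 * K) - 2 * real K * c3 ^ (2 * K - 1) * (n * D)) * ?u
        - n * D * W * (c2 ^ K + c3 ^ K)"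
  proof -
    have q: "c3 ^ (2 * K) = c3 ^ K * c3 ^ K" by (simp add: mult_2 power_add)
    have "n * D * (1 + \<omega> K) / s * c3 ^ K * c2 ^ K + n * D * (1 + \<omega> K) / s * c3 ^ (2 * K)
        = n * D * W * (c2 ^ K + c3 ^ K)"
      unfolding q W_def by (simp add: algebra_simps add_divide_distrib)
    \<comment> \<open>The terms common to both brackets lose their dependence on
      \<open>\<theta>\<close>, as the two sums of squares add up to 1.\<close>
    moreover have "(x - y - y') * ?s + (x' - y - y') * ?u = x * ?s + x' * ?u - (y + y')" for x x' y y'
      using \<theta>1 by algebra
    ultimately show ?thesis unfolding traj_fun_def by (simp only:)
  qed
  ultimately show ?thesis by (simp add: algebra_simps)
qed

section \<open>The spectrum at the saddle and the norm of a trajectory\<close>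

text \<open>The spectral gap at critical points gives the lower bound and the Lipschitz gradient the
  upper one. No eigenvalue is zero, so the signs split all indices, and the saddle property supplies
  both signs.\<close>

lemma strict_saddle_eigenvalues:
  fixes f :: "real^'n \<Rightarrow> real"
  assumes sa: "standing_assumptions f L M \<beta> \<epsilon>" and \<beta>: "\<beta> > 0" and ss: "strict_saddle f xs"
    and op: "orthonormal_eigenpairs (hess f xs) lam v"
  shows "\<And>i. \<beta> < \<bar>lam i\<bar> \<and> \<bar>lam i\<bar> \<le> L"
    and "stable_idx lam \<union> unstable_idx lam = UNIV"
    and "stable_idx lam \<noteq> {}" and "unstable_idx lam \<noteq> {}"
proof -
  have on: "v i \<bullet> v l = (if i = l then 1 else 0)" and ei: "hess f xs *v v i = lam i *\<^sub>R v i" for i l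
    using op by (auto simp: orthonormal_eigenpairs_def)
  have nv: "norm (v i) = 1" for i using on[of i i] by (simp add: norm_eq_1)
  show b: "\<beta> < \<bar>lam i\<bar> \<and> \<bar>lam i\<bar> \<le> L" for i
  proof
    have "is_eigenvalue (hess f xs) (lam i)"
      unfolding is_eigenvalue_def using ei nv[of i] by (intro exI[of _ "v i"]) auto
    then show "\<beta> < \<bar>lam i\<bar>"
      using sa ss by (auto simp: standing_assumptions_def strict_saddle_def)
    show "\<bar>lam i\<bar> \<le> L"
      using sa ei nv by (intro abs_eigenvalue_hess_le[of f xs L "v i"])
        (auto simp: standing_assumptions_def C2_function_def)
  qed
  have "lam i \<noteq> 0" for i using b[of i] \<beta> by auto
  then show "stable_idx lam \<union> unstable_idx lam = UNIV"
    by (auto simp: stable_idx_def unstable_idx_def neq_iff)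
  show "stable_idx lam \<noteq> {}" "unstable_idx lam \<noteq> {}"
    using ss eigenvalue_mem_range[OF op]
    by (fastforce simp: strict_saddle_def stable_idx_def unstable_idx_def)+
qed

lemma norm_eps_traj:
  fixes lam :: "'n::finite \<Rightarrow> real"
  assumes on: "\<And>i l. v i \<bullet> v l = (if i = l then 1 else 0)"
    and SU: "stable_idx lam \<union> unstable_idx lam = UNIV"
  shows "(norm (eps_traj \<epsilon> lam v \<theta> \<tau> K))\<^sup>2 = \<epsilon>\<^sup>2 * (\<Sum>i\<in>UNIV. (traj_coord lam \<tau> \<theta> K i)\<^sup>2)"
proof -
  have "stable_idx lam \<inter> unstable_idx lam = {}"
    by (auto simp: stable_idx_def unstable_idx_def)
  then have "eps_traj \<epsilon> lam v \<theta> \<tau> K = \<epsilon> *\<^sub>R (\<Sum>i\<in>UNIV. traj_coord lam \<tau> \<theta> K i *\<^sub>R v i)"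
    by (simp add: eps_traj_def scaleR_add_right flip: SU add: sum.union_disjoint)
  then show ?thesis
    by (simp add: power_mult_distrib norm_sum_orthonormal[OF on])
qed

section \<open>Uniform constants and the bounds for all trajectories\<close>

theorem theorem3p2:
  fixes L M \<beta> \<kappa> a C :: real
  assumes "L > 0" "M > 0" "\<beta> > 0" "\<kappa> > 0" "0 < a" "a \<le> 1" "C \<ge> 0"
  shows "\<exists>\<eta>>0. \<exists>C'\<ge>0.
    \<forall>(f :: real^'n \<Rightarrow> real) xs (lam :: 'n \<Rightarrow> real) v \<delta> \<alpha> \<epsilon> x0
      e1 e2 e3 e4 e5 E1 E2 h.
      \<epsilon> > 0 \<and> standing_assumptions f L M \<beta> \<epsilon> \<and> strict_saddle f xs
      \<and> orthonormal_eigenpairs (hess f xs) lam v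
      \<and> (\<forall>i l. i \<noteq> l \<longrightarrow> \<bar>lam i - lam l\<bar> \<ge> \<delta>) \<and> \<delta> \<ge> \<kappa> * \<epsilon> powr (1 - a)
      \<and> 0 < \<alpha> \<and> \<alpha> \<le> 1 / L
      \<and> norm (x0 - xs) = \<epsilon> \<and> (\<forall>i. (x0 - xs) \<bullet> v i \<ge> 0)
      \<and> (\<forall>e\<in>{e1, e2, e3, e4, e5}. 0 \<le> e \<and> e \<le> C * \<epsilon>\<^sup>2)
      \<and> \<bar>E1\<bar> \<le> C * \<epsilon>\<^sup>2 \<and> \<bar>E2\<bar> \<le> C * \<epsilon>\<^sup>2 \<and> \<bar>h\<bar> \<le> C * \<epsilon>
      \<and> (\<alpha> \<le> 1 / L - h \<longrightarrow>
           ereal \<epsilon> < min (conv_radius_hess f xs)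
             (ereal (2 * \<delta> * (1 - \<alpha> * L)
                / (\<alpha> * M * (2 * L * (real CARD('n))\<^sup>2 + \<delta>)) + E1)))
      \<and> (1 / L - h < \<alpha> \<longrightarrow>
           ereal \<epsilon> < min (conv_radius_hess f xs)
             (ereal (2 * L * \<delta> / (M * (2 * L * (real CARD('n))\<^sup>2 - \<delta>)) + E2)))
      \<longrightarrow>
      (let n = real CARD('n);
           \<theta> = (\<lambda>i. ((x0 - xs) \<bullet> v i) / \<epsilon>);
           c1 = 1 - \<alpha> * L - \<alpha> * \<epsilon> * M / 2 - e1;
           c2 = 1 - \<alpha> * \<beta> + \<alpha> * \<epsilon> * M / 2 + e2;
           c3 = 1 + \<alpha> * L + \<alpha> * \<epsilon> * M / 2 + e3;
           c4 = 1 + \<alpha> * \<beta> - \<alpha> * \<epsilon> * M / 2 - e4;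
           T = admissible lam c1 c2 c4 c3 (\<alpha> * \<epsilon> * M * L / (2 * \<delta>) + e5);
           u = eps_traj \<epsilon> lam v \<theta>;
           Kexit = (SUP \<tau>\<in>T. exit_time \<epsilon> lam v \<theta> \<tau>);
           b1 = \<alpha> * \<epsilon> * M * L * n / (2 * \<delta>) + n * e5
       in \<exists>g \<omega>. 0 \<le> g \<and> g \<le> C' * \<epsilon>\<^sup>2 \<and> (\<forall>K. \<bar>\<omega> K\<bar> \<le> C' * (real K * \<epsilon>)) \<and>
          (let b2 = (\<lambda>K. b1 * (1 + \<omega> K) / (\<alpha> * L + \<alpha> * \<beta> + g));
               \<Psi> = traj_fun c1 c2 c3 c4 b1 b2
                     (\<Sum>i\<in>stable_idx lam. (\<theta> i)\<^sup>2) (\<Sum>j\<in>unstable_idx lam. (\<theta> j)\<^sup>2)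
           in (\<forall>\<tau>\<in>T. \<forall>K. 1 \<le> K \<and> enat K \<le> Kexit \<and> real K * \<epsilon> \<le> \<eta> \<longrightarrow>
                 \<epsilon>\<^sup>2 * \<Psi> K \<le> (norm (u \<tau> K))\<^sup>2)
            \<and> (\<forall>K. 1 \<le> K \<and> enat K < Kexit \<and> real K * \<epsilon> \<le> \<eta> \<longrightarrow>
                 \<epsilon>\<^sup>2 \<ge> (INF \<tau>\<in>T. (norm (u \<tau> K))\<^sup>2)
                 \<and> (INF \<tau>\<in>T. (norm (u \<tau> K))\<^sup>2) > \<epsilon>\<^sup>2 * \<Psi> K)))"
proof -
  \<comment> \<open>For \<open>\<alpha> \<le> 1 / L\<close> and \<open>\<epsilon> \<le> 1\<close>,
    the perturbation \<open>\<alpha> * \<epsilon> * M / 2 + C * \<epsilon>^2\<close> is at most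
    \<open>\<epsilon> * \<gamma>\<close>.\<close>
  define \<gamma> where "\<gamma> = M / (2 * L) + C"
  \<comment> \<open>For \<open>\<beta> \<ge> L\<close> no \<open>f\<close> satisfies the hypotheses; \<open>\<rho>\<close> then only has to be positive.\<close>
  define \<rho> where "\<rho> = (if \<beta> < L then 1 - \<beta> / L else 1)"
  \<comment> \<open>The entries secure, in order: \<open>\<epsilon> \<le> 1\<close>; the smallness
    of \<open>K * r\<close> for the exponential bound; \<open>- c1 \<le> c2\<close>;
    \<open>\<epsilon> * \<gamma> \<le> 1\<close>, hence \<open>c4 \<ge> 0\<close>; and a surplus
    that exceeds \<open>(\<epsilon> * \<gamma>)^2\<close>. Adding 1 to \<open>C\<close> allows
    \<open>C = 0\<close>.\<close>
  define \<eta> where "\<eta> = Min {1, 1 / (C + 1), \<rho> / (C + 1), 1 / \<gamma>, M / (16 * L * \<gamma>\<^sup>2)}"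
  have \<gamma>: "\<gamma> > 0" unfolding \<gamma>_def using assms by (intro add_pos_nonneg) auto
  have \<rho>: "\<rho> > 0" using assms by (simp add: \<rho>_def)
  have \<eta>: "\<eta> > 0" using assms \<gamma> \<rho> by (simp add: \<eta>_def)
  have \<eta>_le: "\<eta> \<le> 1" "C * \<eta> \<le> 1" "C * \<eta> \<le> \<rho>" "\<gamma> * \<eta> \<le> 1" "16 * L * \<gamma>\<^sup>2 * \<eta> \<le> M"
  proof -
    have le: "\<eta> \<le> 1" "\<eta> \<le> 1 / (C + 1)" "\<eta> \<le> \<rho> / (C + 1)" "\<eta> \<le> 1 / \<gamma>" "\<eta> \<le> M / (16 * L * \<gamma>\<^sup>2)"
      unfolding \<eta>_def by (auto intro!: Min_le)
    have "(C + 1) * \<eta> \<le> 1" "(C + 1) * \<eta> \<le> \<rho>"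
      using le(2,3) assms by (simp_all add: pos_le_divide_eq mult.commute)
    then show "C * \<eta> \<le> 1" "C * \<eta> \<le> \<rho>" using \<eta> by (simp_all add: algebra_simps)
    show "\<eta> \<le> 1" by fact
    show "\<gamma> * \<eta> \<le> 1" using le(4) \<gamma> by (simp add: pos_le_divide_eq mult.commute)
    show "16 * L * \<gamma>\<^sup>2 * \<eta> \<le> M" using le(5) \<gamma> assms by (simp add: pos_le_divide_eq mult.commute)
  qed
  have C2: "2 * C \<ge> 0" using assms by simp
  show ?thesis
  proof (rule exI[of _ \<eta>], rule conjI[OF \<eta>], rule exI[of _ "2 * C"], rule conjI[OF C2],
      intro allI impI, elim conjE)
    fix f :: "real^'n \<Rightarrow> real" and xs x0 :: "real^'n" and lam :: "'n \<Rightarrow> real" and v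
      and \<delta> \<alpha> \<epsilon> e1 e2 e3 e4 e5 :: real
    assume \<epsilon>: "\<epsilon> > 0" and sa: "standing_assumptions f L M \<beta> \<epsilon>" and ss: "strict_saddle f xs"
      and op: "orthonormal_eigenpairs (hess f xs) lam v"
      and gap: "\<forall>i l. i \<noteq> l \<longrightarrow> \<delta> \<le> \<bar>lam i - lam l\<bar>" and \<delta>\<kappa>: "\<kappa> * \<epsilon> powr (1 - a) \<le> \<delta>"
      and \<alpha>: "0 < \<alpha>" "\<alpha> \<le> 1 / L" and x0: "norm (x0 - xs) = \<epsilon>" "\<forall>i. 0 \<le> (x0 - xs) \<bullet> v i"
      and e: "\<forall>e\<in>{e1, e2, e3, e4, e5}. 0 \<le> e \<and> e \<le> C * \<epsilon>\<^sup>2"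
    let ?n = "real CARD('n)"
    let ?\<theta> = "\<lambda>i. ((x0 - xs) \<bullet> v i) / \<epsilon>"
    let ?c1 = "1 - \<alpha> * L - \<alpha> * \<epsilon> * M / 2 - e1"
    let ?c2 = "1 - \<alpha> * \<beta> + \<alpha> * \<epsilon> * M / 2 + e2"
    let ?c3 = "1 + \<alpha> * L + \<alpha> * \<epsilon> * M / 2 + e3"
    let ?c4 = "1 + \<alpha> * \<beta> - \<alpha> * \<epsilon> * M / 2 - e4"
    let ?D = "\<alpha> * \<epsilon> * M * L / (2 * \<delta>) + e5"
    let ?T = "admissible lam ?c1 ?c2 ?c4 ?c3 ?D"
    let ?u = "eps_traj \<epsilon> lam v ?\<theta>"
    let ?Kexit = "SUP \<tau>\<in>?T. exit_time \<epsilon> lam v ?\<theta> \<tau>"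
    let ?b1 = "\<alpha> * \<epsilon> * M * L * ?n / (2 * \<delta>) + ?n * e5"
    \<comment> \<open>The factor 2 comes from the exponential bound with slack
      \<open>r = C * \<epsilon>^2\<close>, using \<open>\<epsilon>^2 \<le> \<epsilon>\<close>. The
      denominator error \<open>g\<close> is taken to be 0.\<close>
    let ?\<omega> = "\<lambda>K::nat. 2 * C * (real K * \<epsilon>)"
    let ?\<Psi> = "traj_fun ?c1 ?c2 ?c3 ?c4 ?b1 (\<lambda>K. ?b1 * (1 + ?\<omega> K) / (\<alpha> * L + \<alpha> * \<beta> + 0))
      (\<Sum>i\<in>stable_idx lam. (?\<theta> i)\<^sup>2) (\<Sum>j\<in>unstable_idx lam. (?\<theta> j)\<^sup>2)"
    let ?s = "\<alpha> * L + \<alpha> * \<beta>"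
    note ev = strict_saddle_eigenvalues[OF sa assms(3) ss op]
    have on: "\<And>i l. v i \<bullet> v l = (if i = l then 1 else 0)"
      using op by (auto simp: orthonormal_eigenpairs_def)
    have disj: "stable_idx lam \<inter> unstable_idx lam = {}"
      by (auto simp: stable_idx_def unstable_idx_def)
    have e': "0 \<le> e1" "0 \<le> e2" "0 \<le> e3" "0 \<le> e4" "0 \<le> e5"
      "e1 \<le> C * \<epsilon>\<^sup>2" "e2 \<le> C * \<epsilon>\<^sup>2" "e3 \<le> C * \<epsilon>\<^sup>2" "e4 \<le> C * \<epsilon>\<^sup>2"
      using e by auto
    have \<beta>L: "\<beta> < L" using ev(1) by (meson less_le_trans)
    have \<delta>: "\<delta> > 0" using \<delta>\<kappa> assms \<epsilon> by (smt (verit) mult_pos_pos powr_gt_zero)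
    \<comment> \<open>One stable and one unstable eigenvalue differ by at most \<open>2 * L\<close>.
      This keeps the coupling bound from below at order
      \<open>\<alpha> * \<epsilon>\<close>.\<close>
    have \<delta>L: "\<delta> \<le> 2 * L"
    proof -
      obtain i l where il: "i \<in> stable_idx lam" "l \<in> unstable_idx lam" using ev(3,4) by auto
      then have "i \<noteq> l" using disj by auto
      then show ?thesis using gap ev(1)[of i] ev(1)[of l] by (smt (verit))
    qed
    have s: "?s > 0" using \<alpha> assms by (simp add: add_pos_pos)
    have \<alpha>L: "\<alpha> * L \<le> 1" using \<alpha> assms by (simp add: field_simps)
    have \<alpha>\<beta>: "\<alpha> * \<beta> \<le> 1 - \<rho>"
      using mult_right_mono[OF \<alpha>(2), of \<beta>] assms \<beta>L by (simp add: \<rho>_def)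
    have \<alpha>M: "\<alpha> * \<epsilon> * M / 2 \<le> \<epsilon> * (M / (2 * L))"
      using mult_right_mono[OF \<alpha>(2), of "\<epsilon> * M / 2"] \<epsilon> assms by (simp add: mult_ac)
    have \<alpha>M0: "0 \<le> \<alpha> * \<epsilon> * M / 2" using \<alpha> \<epsilon> assms by simp
    have D: "?D > 0" using \<alpha> \<epsilon> \<delta> assms e' by (intro add_pos_nonneg divide_pos_pos mult_pos_pos) auto
    have b1: "?b1 = ?n * ?D" by (simp add: algebra_simps)
    have \<theta>0: "?\<theta> i \<ge> 0" for i using x0 \<epsilon> by simp
    have \<theta>1: "(\<Sum>i\<in>stable_idx lam. (?\<theta> i)\<^sup>2) + (\<Sum>j\<in>unstable_idx lam. (?\<theta> j)\<^sup>2) = 1"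
    proof -
      have "(\<Sum>i\<in>stable_idx lam. (?\<theta> i)\<^sup>2) + (\<Sum>j\<in>unstable_idx lam. (?\<theta> j)\<^sup>2)
          = (\<Sum>i\<in>UNIV. (?\<theta> i)\<^sup>2)"
        unfolding ev(2)[symmetric] using disj by (simp add: sum.union_disjoint)
      also have "\<dots> = (\<Sum>i\<in>UNIV. ((x0 - xs) \<bullet> v i)\<^sup>2) / \<epsilon>\<^sup>2"
        by (simp add: power_divide sum_divide_distrib)
      also have "(\<Sum>i\<in>UNIV. ((x0 - xs) \<bullet> v i)\<^sup>2) = (norm (x0 - xs))\<^sup>2"
        by (simp only: orthonormal_expansion[OF on] flip: norm_sum_orthonormal[OF on])
      finally show ?thesis using x0 \<epsilon> by simp
    qed
    \<comment> \<open>The surplus depends on neither \<open>\<tau>\<close> nor \<open>K\<close>, so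
      it survives the infimum over \<open>\<tau>\<close>.\<close>
    have key: "\<epsilon>\<^sup>2 * ?\<Psi> K + \<epsilon>\<^sup>2 * (?D / ?s - (\<epsilon> * \<gamma>)\<^sup>2) \<le> (norm (?u \<tau> K))\<^sup>2
        \<and> ?D / ?s - (\<epsilon> * \<gamma>)\<^sup>2 > 0"
      if \<tau>: "K \<ge> 1" "real K * \<epsilon> \<le> \<eta>" and \<tau>T: "\<tau> \<in> ?T" for \<tau> and K :: nat
    proof -
      have \<epsilon>\<eta>: "\<epsilon> \<le> \<eta>"
        using \<tau> \<epsilon> mult_right_mono[of 1 "real K" \<epsilon>] by linarith
      have \<epsilon>1: "\<epsilon> \<le> 1" using \<epsilon>\<eta> \<eta>_le(1) by linarith
      have C\<epsilon>: "C * \<epsilon>\<^sup>2 \<le> C * \<epsilon>" "C * \<epsilon> \<le> C * \<eta>"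
        using \<epsilon>1 \<epsilon> \<epsilon>\<eta> assms by (auto intro!: mult_left_mono simp: power2_eq_square mult_left_le)
      have \<epsilon>\<gamma>: "\<epsilon> * \<gamma> \<le> 1"
        using mult_left_mono[OF \<epsilon>\<eta> less_imp_le[OF \<gamma>]] \<eta>_le(4)
        by (subst mult.commute) linarith
      have small: "\<alpha> * \<epsilon> * M / 2 + C * \<epsilon>\<^sup>2 \<le> \<epsilon> * \<gamma>"
        using \<alpha>M C\<epsilon> by (simp add: \<gamma>_def algebra_simps)
      have c: "0 \<le> ?c2" "- ?c1 \<le> ?c2" "1 \<le> ?c3" "0 \<le> ?c4"
      proof -
        have "0 \<le> \<alpha> * L" "0 \<le> \<alpha> * \<beta>" using \<alpha> assms by auto
        then show "0 \<le> ?c2" "1 \<le> ?c3" "0 \<le> ?c4"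
          using \<alpha>\<beta> \<alpha>M0 e' small \<epsilon>\<gamma> \<rho> by linarith+
        \<comment> \<open>The terms \<open>\<alpha> * \<epsilon> * M / 2\<close> cancel; what
          remains is \<open>e1 \<le> \<rho>\<close> with
          \<open>\<rho> \<le> 1 - \<alpha> * \<beta>\<close>.\<close>
        show "- ?c1 \<le> ?c2"
          using \<alpha>\<beta> \<alpha>L \<alpha>M0 e' C\<epsilon> \<eta>_le(3) by linarith
      qed
      have z: "(\<epsilon> * \<gamma>)\<^sup>2 < ?D / ?s"
      proof -
        have "16 * L * \<gamma>\<^sup>2 * \<epsilon> \<le> 16 * L * \<gamma>\<^sup>2 * \<eta>"
          using \<epsilon>\<eta> assms by (intro mult_left_mono) auto
        then have "16 * L * \<gamma>\<^sup>2 * \<epsilon> \<le> M" using \<eta>_le(5) by linarith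
        then have "8 * L * \<gamma>\<^sup>2 * \<epsilon> < M" using assms by linarith
        then have "\<epsilon> * (8 * L * \<gamma>\<^sup>2 * \<epsilon>) < \<epsilon> * M" using \<epsilon> by (rule mult_strict_left_mono)
        then have "(\<epsilon> * \<gamma>)\<^sup>2 < \<epsilon> * M / (8 * L)"
          using assms by (simp add: pos_less_divide_eq power_mult_distrib power2_eq_square mult_ac)
        \<comment> \<open>With \<open>\<delta> \<le> 2 * L\<close> and \<open>\<beta> < L\<close>,
          the step size cancels from the lower bound for \<open>?D / ?s\<close>: a first-order
          quantity, uniform in \<open>\<alpha>\<close>, dominates the second-order
          \<open>(\<epsilon> * \<gamma>)^2\<close>.\<close>
        also have "\<dots> = (\<alpha> * \<epsilon> * M * L / (2 * (2 * L))) / (\<alpha> * L + \<alpha> * L)"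
          using \<alpha> assms by (simp add: field_simps)
        also have "\<dots> \<le> ?D / ?s"
        proof (intro frac_le)
          have "\<alpha> * \<epsilon> * M * L / (2 * (2 * L)) \<le> \<alpha> * \<epsilon> * M * L / (2 * \<delta>)"
            using \<alpha> \<epsilon> \<delta> \<delta>L assms by (intro divide_left_mono) auto
          then show "\<alpha> * \<epsilon> * M * L / (2 * (2 * L)) \<le> ?D" using e' by linarith
        qed (use D s \<beta>L \<alpha> in auto)
        finally show ?thesis .
      qed
      have K\<epsilon>: "real K * (C * \<epsilon>\<^sup>2) \<le> C * (real K * \<epsilon>)"
        using mult_left_mono[OF C\<epsilon>(1), of "real K"] by (simp only: mult_ac of_nat_0_le_iff)
      have K\<epsilon>1: "C * (real K * \<epsilon>) \<le> 1"
        using mult_left_mono[OF \<tau>(2) assms(7)] \<eta>_le(2) by linarith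
      have "?\<Psi> K + (?D / ?s - (\<epsilon> * \<gamma>)\<^sup>2)
          \<le> (\<Sum>i\<in>UNIV. (traj_coord lam \<tau> ?\<theta> K i)\<^sup>2)"
        unfolding b1 add_0_right
      proof (rule traj_fun_gap[where r = "C * \<epsilon>\<^sup>2" and \<omega> = ?\<omega>])
        show "\<tau> \<in> ?T" by (fact \<tau>T)
        \<comment> \<open>Since \<open>\<alpha> * L \<le> 1\<close>, only the perturbation can make
          \<open>c1\<close> negative.\<close>
        show "?c1\<^sup>2 \<le> (\<epsilon> * \<gamma>)\<^sup>2" if "?c1 < 0"
        proof -
          have "- ?c1 \<le> \<epsilon> * \<gamma>" using \<alpha>L small e' by linarith
          then have "(- ?c1)\<^sup>2 \<le> (\<epsilon> * \<gamma>)\<^sup>2" using that by (intro power_mono) auto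
          then show ?thesis by (simp only: power2_minus)
        qed
        show "(\<epsilon> * \<gamma>)\<^sup>2 \<le> 1" using \<epsilon>\<gamma> \<epsilon> \<gamma> by (simp add: power_le_one)
        \<comment> \<open>The difference \<open>c3 - c2\<close> equals \<open>?s + e3 - e2\<close>;
          the slack makes up for \<open>e2\<close>.\<close>
        show "?s \<le> ?c3 + C * \<epsilon>\<^sup>2 - ?c2" using e' by linarith
        show "real K * (C * \<epsilon>\<^sup>2) \<le> 1" "2 * (real K * (C * \<epsilon>\<^sup>2)) \<le> ?\<omega> K"
          using K\<epsilon> K\<epsilon>1 by linarith+
        show "0 \<le> C * \<epsilon>\<^sup>2" using assms by simp
      qed (use ev D c s \<tau> \<theta>0 \<theta>1 in \<open>simp_all\<close>)
      from mult_left_mono[OF this, of "\<epsilon>\<^sup>2"] z show ?thesis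
        unfolding norm_eps_traj[OF on ev(2)] distrib_left by simp
    qed
    have lower: "\<forall>\<tau>\<in>?T. \<forall>K. 1 \<le> K \<and> enat K \<le> ?Kexit \<and> real K * \<epsilon> \<le> \<eta> \<longrightarrow>
        \<epsilon>\<^sup>2 * ?\<Psi> K \<le> (norm (?u \<tau> K))\<^sup>2"
    proof (intro ballI allI impI, elim conjE)
      fix \<tau> and K :: nat assume "\<tau> \<in> ?T" "1 \<le> K" "real K * \<epsilon> \<le> \<eta>"
      with key[of K \<tau>] show "\<epsilon>\<^sup>2 * ?\<Psi> K \<le> (norm (?u \<tau> K))\<^sup>2"
        by (smt (verit) mult_nonneg_nonneg zero_le_power2)
    qed
    have inf: "\<forall>K. 1 \<le> K \<and> enat K < ?Kexit \<and> real K * \<epsilon> \<le> \<eta> \<longrightarrow>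
        (INF \<tau>\<in>?T. (norm (?u \<tau> K))\<^sup>2) \<le> \<epsilon>\<^sup>2
        \<and> \<epsilon>\<^sup>2 * ?\<Psi> K < (INF \<tau>\<in>?T. (norm (?u \<tau> K))\<^sup>2)"
    proof (intro allI impI, elim conjE, intro conjI)
      fix K :: nat assume K: "1 \<le> K" "enat K < ?Kexit" "real K * \<epsilon> \<le> \<eta>"
      \<comment> \<open>Below the supremum some trajectory has not yet exited at \<open>K\<close>.
        It gives the upper bound for the infimum and shows that \<open>?T\<close> is
        nonempty.\<close>
      obtain \<tau> where \<tau>: "\<tau> \<in> ?T" "enat K < exit_time \<epsilon> lam v ?\<theta> \<tau>"
        using K(2) by (auto simp: less_SUP_iff)
      have "\<not> (norm (?u \<tau> K))\<^sup>2 > \<epsilon>\<^sup>2"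
      proof
        assume "(norm (?u \<tau> K))\<^sup>2 > \<epsilon>\<^sup>2"
        then have "exit_time \<epsilon> lam v ?\<theta> \<tau> \<le> enat K"
          unfolding exit_time_def using K(1) by (intro Inf_lower) blast
        then show False using \<tau>(2) by simp
      qed
      moreover have "(INF \<tau>\<in>?T. (norm (?u \<tau> K))\<^sup>2) \<le> (norm (?u \<tau> K))\<^sup>2"
        by (rule cINF_lower[OF _ \<tau>(1)]) (auto intro!: bdd_belowI2[where m = 0])
      ultimately show "(INF \<tau>\<in>?T. (norm (?u \<tau> K))\<^sup>2) \<le> \<epsilon>\<^sup>2" by linarith
      \<comment> \<open>The surplus is added before passing to the infimum, where a merely pointwise
        strict inequality could become an equality.\<close>
      have "\<epsilon>\<^sup>2 * ?\<Psi> K + \<epsilon>\<^sup>2 * (?D / ?s - (\<epsilon> * \<gamma>)\<^sup>2) \<le> (INF \<tau>\<in>?T. (norm (?u \<tau> K))\<^sup>2)"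
        using \<tau>(1) key[OF K(1,3)] by (intro cINF_greatest) blast+
      moreover have "\<epsilon>\<^sup>2 * (?D / ?s - (\<epsilon> * \<gamma>)\<^sup>2) > 0"
        using key[OF K(1,3), of \<tau>] \<tau>(1) \<epsilon> by (intro mult_pos_pos) auto
      ultimately show "\<epsilon>\<^sup>2 * ?\<Psi> K < (INF \<tau>\<in>?T. (norm (?u \<tau> K))\<^sup>2)" by linarith
    qed
    have \<omega>: "\<forall>K. \<bar>?\<omega> K\<bar> \<le> 2 * C * (real K * \<epsilon>)" using assms \<epsilon> by simp
    have g: "(0::real) \<le> 0" "0 \<le> 2 * C * \<epsilon>\<^sup>2" using assms by simp_all
    show "let n = real CARD('n);
           \<theta> = (\<lambda>i. ((x0 - xs) \<bullet> v i) / \<epsilon>);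
           c1 = 1 - \<alpha> * L - \<alpha> * \<epsilon> * M / 2 - e1;
           c2 = 1 - \<alpha> * \<beta> + \<alpha> * \<epsilon> * M / 2 + e2;
           c3 = 1 + \<alpha> * L + \<alpha> * \<epsilon> * M / 2 + e3;
           c4 = 1 + \<alpha> * \<beta> - \<alpha> * \<epsilon> * M / 2 - e4;
           T = admissible lam c1 c2 c4 c3 (\<alpha> * \<epsilon> * M * L / (2 * \<delta>) + e5);
           u = eps_traj \<epsilon> lam v \<theta>;
           Kexit = (SUP \<tau>\<in>T. exit_time \<epsilon> lam v \<theta> \<tau>);
           b1 = \<alpha> * \<epsilon> * M * L * n / (2 * \<delta>) + n * e5
       in \<exists>g \<omega>. 0 \<le> g \<and> g \<le> 2 * C * \<epsilon>\<^sup>2 \<and> (\<forall>K. \<bar>\<omega> K\<bar> \<le> 2 * C * (real K * \<epsilon>)) \<and>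
          (let b2 = (\<lambda>K. b1 * (1 + \<omega> K) / (\<alpha> * L + \<alpha> * \<beta> + g));
               \<Psi> = traj_fun c1 c2 c3 c4 b1 b2
                     (\<Sum>i\<in>stable_idx lam. (\<theta> i)\<^sup>2) (\<Sum>j\<in>unstable_idx lam. (\<theta> j)\<^sup>2)
           in (\<forall>\<tau>\<in>T. \<forall>K. 1 \<le> K \<and> enat K \<le> Kexit \<and> real K * \<epsilon> \<le> \<eta> \<longrightarrow>
                 \<epsilon>\<^sup>2 * \<Psi> K \<le> (norm (u \<tau> K))\<^sup>2)
            \<and> (\<forall>K. 1 \<le> K \<and> enat K < Kexit \<and> real K * \<epsilon> \<le> \<eta> \<longrightarrow>
                 \<epsilon>\<^sup>2 \<ge> (INF \<tau>\<in>T. (norm (u \<tau> K))\<^sup>2)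
                 \<and> (INF \<tau>\<in>T. (norm (u \<tau> K))\<^sup>2) > \<epsilon>\<^sup>2 * \<Psi> K))"
      unfolding Let_def
      by (rule exI[of _ 0], rule exI[of _ ?\<omega>]) (intro conjI g \<omega> lower inf)
  qed
qed

end
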